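(* Let $P\subset\mathbb{R}^n$ be an $n$-dimensional simple lattice polytope, let $\Sigma$ be its normal fan, $V\in\mathbb{Z}^{n\times k}$ the matrix whose columns are the primitive inner facet normals of $P$, and $X=X_\Sigma$ the associated projective toric variety. Fix positive real coefficients $c_a$ for the vertices $a\in\mathcal{V}(P)$, let $q=\sum_{a\in\mathcal{V}(P)}c_a t^a\in\mathbb{R}[t_1^{\pm1},\dots,t_n^{\pm1}]$, and consider the resulting moment map $X_{>0}\to P^\circ$. Then the pullback of $\mathrm{d}y_1\cdots\mathrm{d}y_n$ under the moment map $X_{>0}\to P^\circ$ is a positive rational function $r$ times the canonical form $\Omega_X$. The function $r(x)$ is obtained from the determinant $\det H(t)$ of the toric Hessian $H(t)$ of $\log q(t)$ by replacing $t_1,\dots,t_n$ with the Laurent monomials in $x_1,\dots,x_k$ given by the rows of $V$, i.e. $t_j=\prod_{i=1}^k x_i^{V_{ji}}$.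
   Context: Cox coordinates: write $V=[v_1\,\cdots\,v_k]$. The positive part $X_{>0}$ of $X$ is the image of $\mathbb{R}^k_{>0}$ under the Cox quotient map $\pi$, which on $(\mathbb{C}^* )^k$ is the monomial map $x\mapsto t=(\prod_i x_i^{V_{ji}})_{j=1,\dots,n}$ to the dense torus of $X$; this induces an identification $\phi:X_{>0}\simeq\mathbb{R}^n_{>0}$. The canonical form is $\Omega_X=\sum_{|I|=n}\det(V_I)\bigwedge_{i\in I}\frac{\mathrm{d}x_i}{x_i}$, where $V_I$ is the submatrix with columns in $I$; it is the pullback under $\pi$ of $\bigwedge_{j=1}^n\mathrm{d}t_j/t_j$, viewed as a form on $X$. Moment map: let $\theta_i=t_i\partial_{t_i}$ be the $i$-th Euler operator. The affine moment map is $\varphi:\mathbb{R}^n_{>0}\to P^\circ$ ($P^\circ$ the interior of $P$), $$\varphi(t)=\frac{1}{q(t)}\big(\theta_1(q(t)),\dots,\theta_n(q(t))\big)=\sum_{a\in\mathcal{V}(P)}\frac{c_a t^a}{q(t)}\cdot a,$$ which is a diffeomorphism. The moment map $X_{>0}\to P^\circ$ is $\varphi\circ\phi$. The toric Hessian of $\log q$ is the symmetric $n\times n$ matrix $H$ with entries $H_{i,j}=\theta_i\theta_j(\log q(t))$. The coordinates on $P\subset\mathbb{R}^n$ are $y_1,\dots,y_n$. *)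

theory Defs
  imports "HOL-Analysis.Analysis"
begin

section \<open>Lattice polytopes and their normal fans\<close>

definition vertices :: "(real^'n) set \<Rightarrow> (real^'n) set" where
  "vertices P = {a. a extreme_point_of P}"

definition lattice_polytope :: "(real^'n) set \<Rightarrow> bool" where
  "lattice_polytope P \<longleftrightarrow> polytope P \<and> (\<forall>a\<in>vertices P. \<forall>j. a $ j \<in> \<int>)"

definition simple_polytope :: "(real^'n) set \<Rightarrow> bool" where
  "simple_polytope P \<longleftrightarrow> polytope P \<and>
     (\<forall>a\<in>vertices P. int (card {F. F facet_of P \<and> a \<in> F}) = aff_dim P)"

definition real_vec :: "int^'n \<Rightarrow> real^'n" where
  "real_vec v = (\<chi> j. real_of_int (v $ j))"

text \<open>Inner normals: a functional in the cone of a face attains its minimum over the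
  polytope along that face.\<close>

definition normal_cone :: "(real^'n) set \<Rightarrow> (real^'n) set \<Rightarrow> (real^'n) set" where
  "normal_cone P F = {u. \<forall>a\<in>F. \<forall>b\<in>P. u \<bullet> a \<le> u \<bullet> b}"

definition normal_fan :: "(real^'n) set \<Rightarrow> (real^'n) set set" where
  "normal_fan P = {normal_cone P F | F. F face_of P \<and> F \<noteq> {}}"

definition primitive_inner_facet_normals :: "(real^'n) set \<Rightarrow> (int^'n) set" where
  "primitive_inner_facet_normals P =
     {v. Gcd (range (\<lambda>j. v $ j)) = 1 \<and> (\<exists>F. F facet_of P \<and> real_vec v \<in> normal_cone P F)}"

definition facet_normal_matrix :: "(real^'n) set \<Rightarrow> int^'k^'n \<Rightarrow> bool" where
  "facet_normal_matrix P V \<longleftrightarrow>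
     bij_betw (\<lambda>i. column i V) UNIV (primitive_inner_facet_normals P)"

section \<open>Cox coordinates\<close>

definition monomial_map :: "int^'k^'n \<Rightarrow> 'a::field^'k \<Rightarrow> 'a^'n" where
  "monomial_map V x = (\<chi> j. \<Prod>i\<in>UNIV. (x $ i) powi (V $ j $ i))"

text \<open>The complement of the vanishing locus of the irrelevant ideal, which is generated by the
  monomials \<open>\<Prod>i | v\<^sub>i \<notin> \<sigma>. x\<^sub>i\<close> for the cones \<open>\<sigma>\<close> of the fan.\<close>

definition cox_total_space :: "(real^'n) set \<Rightarrow> int^'k^'n \<Rightarrow> (complex^'k) set" where
  "cox_total_space P V =
     {x. \<exists>\<sigma>\<in>normal_fan P. (\<Prod>i | real_vec (column i V) \<notin> \<sigma>. x $ i) \<noteq> 0}"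

definition cox_group :: "int^'k^'n \<Rightarrow> (complex^'k) set" where
  "cox_group V = {g. (\<forall>i. g $ i \<noteq> 0) \<and> monomial_map V g = 1}"

definition cox_rel :: "(real^'n) set \<Rightarrow> int^'k^'n \<Rightarrow> ((complex^'k) \<times> (complex^'k)) set" where
  "cox_rel P V = {(x, y). x \<in> cox_total_space P V \<and> y \<in> cox_total_space P V \<and>
     (\<exists>g\<in>cox_group V. y = g * x)}"

text \<open>The closed points of the toric variety of the normal fan. For a simple polytope the fan
  is simplicial, so that the Cox quotient is geometric and its points are the orbits.\<close>

definition toric_variety :: "(real^'n) set \<Rightarrow> int^'k^'n \<Rightarrow> (complex^'k) set set" where
  "toric_variety P V = cox_total_space P V // cox_rel P V"

definition cox_quotient :: "(real^'n) set \<Rightarrow> int^'k^'n \<Rightarrow> complex^'k \<Rightarrow> (complex^'k) set" where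
  "cox_quotient P V x = cox_rel P V `` {x}"

definition positive_orthant :: "(real^'k) set" where
  "positive_orthant = {x. \<forall>i. x $ i > 0}"

definition complex_vec :: "real^'k \<Rightarrow> complex^'k" where
  "complex_vec x = (\<chi> i. complex_of_real (x $ i))"

definition toric_positive_part :: "(real^'n) set \<Rightarrow> int^'k^'n \<Rightarrow> (complex^'k) set set" where
  "toric_positive_part P V =
     {p \<in> toric_variety P V. \<exists>x\<in>positive_orthant. p = cox_quotient P V (complex_vec x)}"

text \<open>The identification of the positive part with the positive orthant of the torus that is
  induced by the monomial map.\<close>

definition torus_coordinates ::
    "(real^'n) set \<Rightarrow> int^'k^'n \<Rightarrow> (complex^'k) set \<Rightarrow> real^'n" where
  "torus_coordinates P V p =
     (THE t. \<exists>x\<in>positive_orthant. p = cox_quotient P V (complex_vec x) \<and> t = monomial_map V x)"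

section \<open>Moment map and toric Hessian\<close>

text \<open>The floor only converts the integral coordinates of a lattice point to type \<open>int\<close>.\<close>

definition laurent_monomial :: "real^'n \<Rightarrow> real^'n \<Rightarrow> real" where
  "laurent_monomial a t = (\<Prod>j\<in>UNIV. (t $ j) powi \<lfloor>a $ j\<rfloor>)"

definition vertex_polynomial :: "(real^'n) set \<Rightarrow> (real^'n \<Rightarrow> real) \<Rightarrow> real^'n \<Rightarrow> real" where
  "vertex_polynomial P c t = (\<Sum>a\<in>vertices P. c a * laurent_monomial a t)"

definition partial_derivative :: "'n \<Rightarrow> (real^'n \<Rightarrow> real) \<Rightarrow> real^'n \<Rightarrow> real" where
  "partial_derivative j f t = deriv (\<lambda>s. f (t + s *\<^sub>R axis j 1)) 0"

definition euler_operator :: "'n \<Rightarrow> (real^'n \<Rightarrow> real) \<Rightarrow> real^'n \<Rightarrow> real" where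
  "euler_operator j f t = t $ j * partial_derivative j f t"

definition affine_moment_map ::
    "(real^'n) set \<Rightarrow> (real^'n \<Rightarrow> real) \<Rightarrow> real^'n \<Rightarrow> real^'n" where
  "affine_moment_map P c t =
     (1 / vertex_polynomial P c t) *\<^sub>R (\<chi> j. euler_operator j (vertex_polynomial P c) t)"

definition moment_map ::
    "(real^'n) set \<Rightarrow> int^'k^'n \<Rightarrow> (real^'n \<Rightarrow> real) \<Rightarrow> (complex^'k) set \<Rightarrow> real^'n" where
  "moment_map P V c =
     restrict (affine_moment_map P c \<circ> torus_coordinates P V) (toric_positive_part P V)"

definition toric_hessian :: "(real^'n \<Rightarrow> real) \<Rightarrow> real^'n \<Rightarrow> real^'n^'n" where
  "toric_hessian f t = (\<chi> i j. euler_operator i (euler_operator j f) t)"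

section \<open>Differential forms\<close>

text \<open>A differential form of degree \<open>CARD('n)\<close> on (an open subset of) \<open>\<real>\<^sup>m\<close> sends a point and a
  tuple of tangent vectors, indexed by \<open>'n\<close>, to a number.\<close>

type_synonym ('m, 'n) form = "real^'m \<Rightarrow> ('n \<Rightarrow> real^'m) \<Rightarrow> real"

definition wedge :: "('n::finite \<Rightarrow> real^'m \<Rightarrow> real^'m \<Rightarrow> real) \<Rightarrow> ('m, 'n) form" where
  "wedge \<alpha> x w = det (\<chi> i j. \<alpha> i x (w j))"

definition pullback :: "(real^'k \<Rightarrow> real^'m) \<Rightarrow> ('m, 'n) form \<Rightarrow> ('k, 'n) form" where
  "pullback f \<omega> x w = \<omega> (f x) (\<lambda>j. frechet_derivative f (at x) (w j))"

definition coord_differential :: "'m \<Rightarrow> real^'m \<Rightarrow> real^'m \<Rightarrow> real" where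
  "coord_differential i x w = w $ i"

definition log_differential :: "'m \<Rightarrow> real^'m \<Rightarrow> real^'m \<Rightarrow> real" where
  "log_differential i x w = w $ i / x $ i"

definition volume_form :: "('n::finite, 'n) form" where
  "volume_form = wedge coord_differential"

definition increasing_enumeration :: "'k::linorder set \<Rightarrow> 'n::linorder \<Rightarrow> 'k" where
  "increasing_enumeration I = (THE e. strict_mono e \<and> range e = I)"

definition column_submatrix ::
    "int^'k::{finite,linorder}^'n::{finite,linorder} \<Rightarrow> 'k set \<Rightarrow>
       int^'n::{finite,linorder}^'n::{finite,linorder}" where
  "column_submatrix V I = (\<chi> j l. V $ j $ increasing_enumeration I l)"

text \<open>Forms on the positive part of the toric variety are written in Cox coordinates, i.e. they are
  represented by their pullbacks to the positive orthant along the Cox quotient map, which is a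
  surjective submersion onto the positive part.\<close>

definition canonical_form ::
    "int^'k::{finite,linorder}^'n::{finite,linorder} \<Rightarrow> ('k, 'n) form" where
  "canonical_form V x w =
     (\<Sum>I | card I = CARD('n). real_of_int (det (column_submatrix V I)) *
        wedge (\<lambda>l. log_differential (increasing_enumeration I l)) x w)"

section \<open>Rational functions\<close>

definition rational_function_on :: "(real^'k) set \<Rightarrow> (real^'k \<Rightarrow> real) \<Rightarrow> bool" where
  "rational_function_on S r \<longleftrightarrow>
     (\<exists>f g. real_polynomial_function f \<and> real_polynomial_function g \<and>
        (\<forall>x\<in>S. g x \<noteq> 0 \<and> r x = f x / g x))"

end

theory Submission
  imports Defs
begin

text \<open>In logarithmic coordinates every map in sight is either linear or a mean.  On the positive orthant
  the moment map, written in Cox coordinates, is \<open>x \<mapsto> \<phi>(t)\<close>, where \<open>t\<close> is the image of \<open>x\<close> under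
  the monomial map of \<open>V\<close> and \<open>\<phi>\<close> is the affine moment map (\<open>moment_map_cox_quotient\<close>).  The
  monomial map pulls \<open>dt\<^sub>j / t\<^sub>j\<close> back to \<open>\<Sum>\<^sub>i V\<^sub>j\<^sub>i dx\<^sub>i / x\<^sub>i\<close>, and the components of \<open>\<phi>\<close> are
  the Euler derivatives \<open>\<theta>\<^sub>j (log q)\<close>, so their logarithmic gradients are the columns of the toric
  Hessian \<open>H\<close>.  The chain rule thus identifies the pullback of the volume form, evaluated on tangent
  vectors \<open>w\<close>, with \<open>det (H\<^sup>T V W)\<close>, where \<open>W\<^sub>i\<^sub>l = dx\<^sub>i(w\<^sub>l) / x\<^sub>i\<close>.  This equals \<open>det H\<close> times
  \<open>det (V W)\<close>, and expanding the second factor by the Cauchy-Binet formula (\<open>cauchy_binet\<close>) gives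
  exactly the canonical form (\<open>canonical_form_eq_det\<close>).

  The factor \<open>r = det H\<close> is positive for a probabilistic reason.  The weights \<open>c\<^sub>a t\<^sup>a / q(t)\<close> form a
  probability distribution on the vertices of \<open>P\<close>, the point \<open>\<phi>(t)\<close> is its mean, and \<open>H\<close> is its
  covariance matrix.  The quadratic form of \<open>H\<close> at \<open>v\<close> is the variance of the function
  \<open>a \<mapsto> v \<bullet> a\<close>, which vanishes only if that function is constant on the vertices
  (\<open>covariance_quadratic_form\<close>); for \<open>v \<noteq> 0\<close> this would put the full-dimensional polytope \<open>P\<close>
  inside a hyperplane.  The same formula presents the entries of \<open>H\<close> as rational functions of
  Laurent monomials in \<open>x\<close>.\<close>

section \<open>The Cauchy-Binet formula\<close>

lemma increasing_enumeration_exists: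
  fixes I :: "'k::{finite,linorder} set"
  assumes "card I = CARD('n::{finite,linorder})"
  shows "\<exists>e :: 'n \<Rightarrow> 'k. strict_mono e \<and> range e = I"
proof -
  define xs where "xs = sorted_list_of_set I"
  define pos :: "'n \<Rightarrow> nat" where "pos i = card {i'. i' < i}" for i
  define e where "e i = xs ! pos i" for i
  have len: "length xs = CARD('n)" and xs: "sorted_wrt (<) xs" "set xs = I"
    by (simp_all add: xs_def assms)
  have pos_bound: "pos i < length xs" for i
    unfolding len pos_def by (rule psubset_card_mono) auto
  have pos_mono: "pos i < pos j" if "i < j" for i j
    unfolding pos_def using that by (intro psubset_card_mono) (auto dest: less_trans)
  have mono: "strict_mono e"
    unfolding strict_mono_def e_def
    using sorted_wrt_nth_less[OF xs(1)] pos_mono pos_bound by blast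
  have "range e \<subseteq> I"
    using pos_bound xs(2) by (auto simp: e_def)
  moreover have "card (range e) = card I"
    using card_image[OF strict_mono_imp_inj_on[OF mono]] assms by simp
  ultimately have "range e = I"
    by (simp add: card_subset_eq)
  with mono show ?thesis by blast
qed

text \<open>Mapping a strictly monotone function over the sorted list of its domain yields a strictly sorted
  list of its range, and such a list is determined by its set of elements.\<close>

lemma strict_mono_range_unique:
  fixes e e' :: "'n::{finite,linorder} \<Rightarrow> 'k::linorder"
  assumes "strict_mono e" "strict_mono e'" "range e = range e'"
  shows "e = e'"
proof -
  let ?ns = "sorted_list_of_set (UNIV :: 'n set)"
  have sorted: "sorted_wrt (<) (map f ?ns)" if "strict_mono f" for f :: "'n \<Rightarrow> 'k"
    unfolding sorted_wrt_map
    by (rule sorted_wrt_mono_rel[of _ "(<)"]) (use that in \<open>auto simp: strict_mono_def\<close>)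
  have "map e ?ns = map e' ?ns"
    by (rule strict_sorted_equal[OF sorted sorted]) (use assms in auto)
  then show ?thesis
    by (auto simp: map_eq_conv)
qed

lemma increasing_enumeration:
  fixes I :: "'k::{finite,linorder} set"
  assumes "card I = CARD('n::{finite,linorder})"
  shows "inj (increasing_enumeration I :: 'n \<Rightarrow> 'k)"
    and "range (increasing_enumeration I :: 'n \<Rightarrow> 'k) = I"
proof -
  let ?e = "increasing_enumeration I :: 'n \<Rightarrow> 'k"
  have "\<exists>!e :: 'n \<Rightarrow> 'k. strict_mono e \<and> range e = I"
    using increasing_enumeration_exists[OF assms] strict_mono_range_unique by blast
  then have "strict_mono ?e \<and> range ?e = I"
    unfolding increasing_enumeration_def by (rule theI')
  then show "inj ?e" "range ?e = I"
    by (auto intro: strict_mono_imp_inj_on)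
qed

text \<open>The contribution of one \<open>n\<close>-element set of columns to the Cauchy-Binet formula: the injections
  with range \<open>range e\<close> are the functions \<open>e \<circ> p\<close> for permutations \<open>p\<close>, and sorting the rows of
  \<open>B\<close> costs the sign of \<open>p\<close>, which turns the sum into the Leibniz formula for the minor of \<open>A\<close>.\<close>

lemma sum_prod_det_rows:
  fixes A :: "'a::comm_ring_1^'k^'n::finite" and B :: "'a^'n^'k"
  assumes "inj e"
  shows "(\<Sum>f | inj f \<and> range f = range e. (\<Prod>i\<in>UNIV. A $ i $ f i) * det (\<chi> i. B $ f i)) =
    det (\<chi> i l. A $ i $ e l) * det (\<chi> l. B $ e l)"
proof -
  have bij: "bij_betw (\<lambda>p. e \<circ> p) {p. p permutes UNIV} {f. inj f \<and> range f = range e}"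
    unfolding bij_betw_def
  proof (intro conjI equalityI subsetI)
    show "inj_on (\<lambda>p. e \<circ> p) {p. p permutes UNIV}"
      using fun.inj_map[OF \<open>inj e\<close>] by (rule inj_on_subset) simp
  next
    fix f :: "'n \<Rightarrow> 'k" assume "f \<in> (\<lambda>p. e \<circ> p) ` {p. p permutes UNIV}"
    then obtain p where p: "p permutes UNIV" "f = e \<circ> p" by auto
    then have "inj p" "range p = UNIV"
      by (auto simp: permutes_inj permutes_surj)
    with p \<open>inj e\<close> show "f \<in> {f. inj f \<and> range f = range e}"
      by (simp add: inj_compose) (metis image_image)
  next
    fix f :: "'n \<Rightarrow> 'k" assume "f \<in> {f. inj f \<and> range f = range e}"
    then have f: "inj f" "range f = range e" by auto
    define p where "p = inv e \<circ> f"
    have ep: "e \<circ> p = f"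
    proof
      fix i
      have "f i \<in> range e" using f(2) by blast
      then show "(e \<circ> p) i = f i" by (simp add: p_def f_inv_into_f)
    qed
    then have "inj p" using f(1) by (metis inj_on_imageI2)
    then have "p permutes UNIV"
      by (intro bij_imp_permutes) (simp_all add: bij_betw_def finite_UNIV_inj_surj)
    with ep show "f \<in> (\<lambda>p. e \<circ> p) ` {p. p permutes UNIV}" by blast
  qed
  have "(\<Sum>f | inj f \<and> range f = range e. (\<Prod>i\<in>UNIV. A $ i $ f i) * det (\<chi> i. B $ f i)) =
      (\<Sum>p | p permutes UNIV. (\<Prod>i\<in>UNIV. A $ i $ e (p i)) * det (\<chi> i. B $ e (p i)))"
    by (subst sum.reindex_bij_betw[OF bij, symmetric]) simp
  also have "\<dots> = (\<Sum>p | p permutes UNIV.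
      (of_int (sign p) * (\<Prod>i\<in>UNIV. A $ i $ e (p i))) * det (\<chi> l. B $ e l))"
  proof (rule sum.cong[OF refl])
    fix p :: "'n \<Rightarrow> 'n" assume "p \<in> {p. p permutes UNIV}"
    then have "det (\<chi> i. B $ e (p i)) = of_int (sign p) * det (\<chi> l. B $ e l)"
      using det_permute_rows[of p "\<chi> l. B $ e l"] by simp
    then show "(\<Prod>i\<in>UNIV. A $ i $ e (p i)) * det (\<chi> i. B $ e (p i)) =
        (of_int (sign p) * (\<Prod>i\<in>UNIV. A $ i $ e (p i))) * det (\<chi> l. B $ e l)"
      by (simp add: mult_ac)
  qed
  finally show ?thesis
    by (simp add: det_def sum_distrib_right)
qed

text \<open>Expanding each row of \<open>A B\<close> as a combination of the rows of \<open>B\<close> gives a sum over all choices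
  \<open>f\<close> of one row of \<open>B\<close> for every row of \<open>A\<close>.  A choice with a repetition contributes a determinant
  with two equal rows; the injective choices are grouped by their range.\<close>

lemma cauchy_binet:
  fixes A :: "'a::comm_ring_1^'k::{finite,linorder}^'n::{finite,linorder}" 
    and B :: "'a^'n::{finite,linorder}^'k::{finite,linorder}"
  shows "det (A ** B) = (\<Sum>I | card I = CARD('n).
    det (\<chi> i l. A $ i $ increasing_enumeration I l) *
    det (\<chi> l :: 'n. B $ increasing_enumeration I l))"
proof -
  define summand where "summand f = (\<Prod>i\<in>UNIV. A $ i $ f i) * det (\<chi> i. B $ f i)" for f
  have "(\<Prod>i\<in>UNIV. (A ** B) $ i $ p i) =
      (\<Sum>f\<in>UNIV. (\<Prod>i\<in>UNIV. A $ i $ f i) * (\<Prod>i\<in>UNIV. B $ f i $ p i))" for p :: "'n \<Rightarrow> 'n"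
    unfolding matrix_matrix_mult_def
    by (simp add: prod_sum_PiE prod.distrib)
  then have "det (A ** B) = (\<Sum>p | p permutes UNIV. \<Sum>f\<in>UNIV.
      (\<Prod>i\<in>UNIV. A $ i $ f i) * (of_int (sign p) * (\<Prod>i\<in>UNIV. B $ f i $ p i)))"
    unfolding det_def by (simp only: sum_distrib_left mult.left_commute)
  also have "\<dots> = (\<Sum>f\<in>UNIV. summand f)"
    unfolding summand_def det_def sum_distrib_left
    by (subst sum.swap) simp
  also have "(\<Sum>f\<in>UNIV. summand f) = (\<Sum>f | inj f. summand f)"
  proof (rule sum.mono_neutral_right)
    show "\<forall>f\<in>UNIV - {f. inj f}. summand f = 0"
    proof
      fix f :: "'n \<Rightarrow> 'k" assume "f \<in> UNIV - {f. inj f}"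
      then obtain i j where "i \<noteq> j" "f i = f j" by (auto simp: inj_def)
      then have "det (\<chi> i. B $ f i) = 0"
        by (intro det_identical_rows[of i j]) (auto simp: row_def)
      then show "summand f = 0" by (simp add: summand_def)
    qed
  qed auto
  also have "\<dots> = (\<Sum>I | card I = CARD('n). \<Sum>f | f \<in> {f. inj f} \<and> range f = I. summand f)"
    by (rule sum.group[symmetric]) (auto simp: card_image)
  also have "\<dots> = (\<Sum>I | card I = CARD('n).
      det (\<chi> i l. A $ i $ increasing_enumeration I l) *
      det (\<chi> l :: 'n. B $ increasing_enumeration I l))"
  proof (rule sum.cong[OF refl])
    fix I :: "'k set" assume "I \<in> {I. card I = CARD('n)}"
    then have "card I = CARD('n)" by simp
    note e = increasing_enumeration[OF this]
    show "(\<Sum>f | f \<in> {f. inj f} \<and> range f = I. summand f) =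
      det (\<chi> i l. A $ i $ increasing_enumeration I l) *
      det (\<chi> l :: 'n. B $ increasing_enumeration I l)"
      using sum_prod_det_rows[OF e(1), of A B] by (simp add: e(2) summand_def)
  qed
  finally show ?thesis .
qed

lemma det_of_int_matrix:
  fixes M :: "int^'n::finite^'n"
  shows "(of_int (det M) :: 'a::comm_ring_1) = det (\<chi> i j. of_int (M $ i $ j))"
  by (simp add: det_def)

section \<open>Determinants of positive definite matrices\<close>

text \<open>The segment from the identity matrix to \<open>H\<close> consists of positive definite, hence invertible,
  matrices, so the determinant cannot change sign along it.\<close>

lemma det_positive_definite:
  fixes H :: "real^'n::finite^'n"
  assumes "\<And>v. v \<noteq> 0 \<Longrightarrow> v \<bullet> (H *v v) > 0"
  shows "det H > 0"
proof (rule ccontr)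
  assume "\<not> det H > 0"
  define Q where "Q s = (1 - s) *\<^sub>R mat 1 + s *\<^sub>R H" for s :: real
  have "continuous_on {0..1} (\<lambda>s. det (Q s))"
    unfolding det_def Q_def by (intro continuous_intros)
  moreover have "det (Q 0) = 1" "det (Q 1) = det H"
    by (simp_all add: Q_def)
  ultimately obtain s where s: "0 \<le> s" "s \<le> 1" "det (Q s) = 0"
    using IVT2'[of "\<lambda>s. det (Q s)" 1 0 0] \<open>\<not> det H > 0\<close> by force
  then obtain v where v: "v \<noteq> 0" "Q s *v v = 0"
    using invertible_det_nz[of "Q s"] matrix_left_invertible_ker[of "Q s"]
    by (auto simp: invertible_left_inverse)
  have "v \<bullet> (Q s *v v) = (1 - s) * (v \<bullet> v) + s * (v \<bullet> (H *v v))"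
    by (simp add: Q_def matrix_vector_mult_add_rdistrib scaleR_matrix_vector_assoc[symmetric]
        inner_add_right)
  also have "\<dots> > 0"
  proof (cases "s = 0")
    case False
    then have "s * (v \<bullet> (H *v v)) > 0" using s assms[OF v(1)] by simp
    moreover have "(1 - s) * (v \<bullet> v) \<ge> 0" using s by simp
    ultimately show ?thesis by linarith
  qed (use v(1) in simp)
  finally show False using v(2) by simp
qed

section \<open>The moment map in Cox coordinates\<close>

lemma complex_vec_monomial_map:
  "monomial_map V (complex_vec x) = complex_vec (monomial_map V x)"
  by (simp add: monomial_map_def complex_vec_def vec_eq_iff of_real_power_int)

lemma monomial_map_mult:
  "monomial_map V (g * x) = monomial_map V g * monomial_map V x"
  by (simp add: monomial_map_def vec_eq_iff power_int_mult_distrib prod.distrib)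

lemma monomial_map_positive:
  "x \<in> positive_orthant \<Longrightarrow> monomial_map V x \<in> positive_orthant"
  by (simp add: positive_orthant_def monomial_map_def prod_pos)

text \<open>The cone of the face \<open>P\<close> itself serves as the cone of the fan; no coordinate of a positive point
  vanishes, so every generator of the irrelevant ideal is nonzero there.\<close>

lemma complex_vec_in_cox_total_space:
  assumes "P \<noteq> {}" "convex P" "x \<in> positive_orthant"
  shows "complex_vec x \<in> cox_total_space P V"
proof -
  have "normal_cone P P \<in> normal_fan P"
    using assms face_of_refl unfolding normal_fan_def by blast
  moreover have "complex_vec x $ i \<noteq> 0" for i
    using assms(3) by (simp add: complex_vec_def positive_orthant_def order_less_imp_not_eq2)
  ultimately show ?thesis
    unfolding cox_total_space_def by fastforce
qed

text \<open>Points of the same orbit differ by an element of the kernel of the monomial map, so the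
  torus coordinates are well defined on the positive part.\<close>

lemma monomial_map_cong_cox_quotient:
  assumes "P \<noteq> {}" "convex P" "x \<in> positive_orthant" "y \<in> positive_orthant"
    and eq: "cox_quotient P V (complex_vec x) = cox_quotient P V (complex_vec y)"
  shows "monomial_map V x = monomial_map V y"
proof -
  have "1 \<in> cox_group V"
    by (simp add: cox_group_def monomial_map_def vec_eq_iff)
  then have "complex_vec y \<in> cox_quotient P V (complex_vec y)"
    using complex_vec_in_cox_total_space[OF assms(1,2,4)]
    by (auto simp: cox_quotient_def cox_rel_def intro!: bexI[of _ 1])
  then obtain g where "g \<in> cox_group V" "complex_vec y = g * complex_vec x"
    unfolding eq[symmetric] by (auto simp: cox_quotient_def cox_rel_def)
  then have "complex_vec (monomial_map V y) = complex_vec (monomial_map V x)"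
    by (simp add: complex_vec_monomial_map[symmetric] monomial_map_mult cox_group_def)
  then show ?thesis
    by (simp add: complex_vec_def vec_eq_iff)
qed

lemma moment_map_cox_quotient:
  assumes "P \<noteq> {}" "convex P" "x \<in> positive_orthant"
  shows "moment_map P V c (cox_quotient P V (complex_vec x)) =
    affine_moment_map P c (monomial_map V x)"
proof -
  let ?p = "cox_quotient P V (complex_vec x)"
  have "?p \<in> toric_positive_part P V"
    using complex_vec_in_cox_total_space[OF assms] assms(3)
    by (auto simp: toric_positive_part_def toric_variety_def cox_quotient_def intro: quotientI)
  moreover have "torus_coordinates P V ?p = monomial_map V x"
    unfolding torus_coordinates_def
    using assms monomial_map_cong_cox_quotient by (intro the_equality) blast+
  ultimately show ?thesis
    by (simp add: moment_map_def)
qed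

section \<open>Logarithmic gradients\<close>

lemma open_positive_orthant: "open (positive_orthant :: (real^'n) set)"
proof -
  have "positive_orthant = (\<Inter>i. {x :: real^'n. 0 < x $ i})"
    by (auto simp: positive_orthant_def)
  also have "open \<dots>"
    by (intro open_INT ballI open_Collect_less continuous_intros) auto
  finally show ?thesis .
qed

text \<open>The differential of \<open>f\<close> at \<open>t\<close> is \<open>\<Sum>\<^sub>j G\<^sub>j dt\<^sub>j / t\<^sub>j\<close>.  If no coordinate of \<open>t\<close> vanishes, then
  \<open>G\<^sub>j\<close> is the value of the Euler operator \<open>\<theta>\<^sub>j\<close>; in this basis the derivative of a monomial is
  given by its exponent vector.\<close>

definition has_log_gradient ::
    "(real^'n::finite \<Rightarrow> real) \<Rightarrow> ('n \<Rightarrow> real) \<Rightarrow> real^'n \<Rightarrow> bool" where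
  "has_log_gradient f G t \<longleftrightarrow> (f has_derivative (\<lambda>h. \<Sum>j\<in>UNIV. G j * (h $ j / t $ j))) (at t)"

lemma euler_operator_eqI:
  assumes "has_log_gradient f G t" "t $ j \<noteq> 0"
  shows "euler_operator j f t = G j"
proof -
  let ?D = "\<lambda>h. \<Sum>j\<in>UNIV. G j * (h $ j / t $ j)"
  have D: "(\<lambda>s. ?D (s *\<^sub>R axis j 1)) = (*) (G j / t $ j)"
    by (rule ext, subst sum.remove[of _ j]) (auto simp: axis_def intro!: sum.neutral)
  moreover have "((\<lambda>s. f (t + s *\<^sub>R axis j 1)) has_derivative (\<lambda>s. ?D (s *\<^sub>R axis j 1))) (at 0)"
    by (rule has_derivative_compose[where g = f])
      (use assms(1) in \<open>auto simp: has_log_gradient_def intro!: derivative_eq_intros\<close>)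
  ultimately have "((\<lambda>s. f (t + s *\<^sub>R axis j 1)) has_field_derivative G j / t $ j) (at 0)"
    by (simp only: D has_field_derivative_def)
  then show ?thesis
    using assms(2) by (simp add: euler_operator_def partial_derivative_def DERIV_imp_deriv)
qed

lemma has_log_gradient_cong:
  assumes "has_log_gradient g G t" "t \<in> positive_orthant"
    and "\<And>s. s \<in> positive_orthant \<Longrightarrow> f s = g s"
  shows "has_log_gradient f G t"
  using has_derivative_transform_within_open[OF _ open_positive_orthant assms(2), of g _ UNIV f]
    assms(1,3) by (simp add: has_log_gradient_def)

lemma has_log_gradient_cmult:
  assumes "has_log_gradient f G t"
  shows "has_log_gradient (\<lambda>t. b * f t) (\<lambda>j. b * G j) t"
  using has_derivative_mult_right[OF assms[unfolded has_log_gradient_def], of b]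
  by (simp add: has_log_gradient_def sum_distrib_left mult.assoc)

lemma has_log_gradient_sum:
  assumes "\<And>a. a \<in> A \<Longrightarrow> has_log_gradient (f a) (G a) t"
  shows "has_log_gradient (\<lambda>t. \<Sum>a\<in>A. f a t) (\<lambda>j. \<Sum>a\<in>A. G a j) t"
  unfolding has_log_gradient_def sum_distrib_right
  by (subst sum.swap, rule has_derivative_sum) (use assms in \<open>simp add: has_log_gradient_def\<close>)

lemma has_log_gradient_divide:
  assumes "has_log_gradient f F t" "has_log_gradient g G t" "g t \<noteq> 0"
  shows "has_log_gradient (\<lambda>t. f t / g t) (\<lambda>j. F j / g t - f t * G j / (g t)\<^sup>2) t"
proof -
  let ?D = "\<lambda>F h. \<Sum>j\<in>UNIV. F j * (h $ j / t $ j)"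
  have "?D (\<lambda>j. F j / g t - f t * G j / (g t)\<^sup>2) h =
      (?D F h * g t - f t * ?D G h) / (g t * g t)" for h :: "real^'a"
  proof -
    have "?D (\<lambda>j. F j / g t - f t * G j / (g t)\<^sup>2) h =
        (\<Sum>j\<in>UNIV. F j * (h $ j / t $ j) / g t - f t / (g t)\<^sup>2 * (G j * (h $ j / t $ j)))"
      by (intro sum.cong) (auto simp: algebra_simps)
    also have "\<dots> = ?D F h / g t - f t / (g t)\<^sup>2 * ?D G h"
      by (simp add: sum_subtractf sum_divide_distrib sum_distrib_left)
    finally show ?thesis
      using assms(3) by (simp add: field_simps power2_eq_square)
  qed
  then show ?thesis
    using has_derivative_divide'[OF assms(1,2)[unfolded has_log_gradient_def] assms(3)]
    by (simp add: has_log_gradient_def)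
qed

lemma has_log_gradient_ln:
  assumes "has_log_gradient f F t" "f t > 0"
  shows "has_log_gradient (\<lambda>t. ln (f t)) (\<lambda>j. F j / f t) t"
proof -
  have "(\<Sum>j\<in>UNIV. F j * (h $ j / t $ j)) * inverse (f t) =
      (\<Sum>j\<in>UNIV. F j / f t * (h $ j / t $ j))" for h
    unfolding sum_distrib_right by (simp add: divide_inverse mult_ac)
  then show ?thesis
    using has_derivative_ln[OF assms(2) assms(1)[unfolded has_log_gradient_def]]
    by (simp only: has_log_gradient_def)
qed

lemma has_log_gradient_monomial:
  assumes "t \<in> positive_orthant"
  shows "has_log_gradient (\<lambda>t. \<Prod>j\<in>UNIV. t $ j powi m j)
    (\<lambda>j. of_int (m j) * (\<Prod>j\<in>UNIV. t $ j powi m j)) t"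
proof -
  have pos: "t $ j > 0" for j using assms by (simp add: positive_orthant_def)
  have "((\<lambda>t. \<Prod>j\<in>UNIV. t $ j powi m j) has_derivative
      (\<lambda>h. \<Sum>j\<in>UNIV. h $ j * (of_int (m j) * t $ j powi (m j - 1)) *
        (\<Prod>j'\<in>UNIV - {j}. t $ j' powi m j'))) (at t)"
  proof (rule has_derivative_prod)
    fix j
    show "((\<lambda>t. t $ j powi m j) has_derivative
        (\<lambda>h. h $ j * (of_int (m j) * t $ j powi (m j - 1)))) (at t)"
      using pos[of j]
      by (intro has_derivative_power_int bounded_linear_imp_has_derivative bounded_linear_vec_nth) simp
  qed
  moreover have "h $ j * (of_int (m j) * t $ j powi (m j - 1)) * (\<Prod>j'\<in>UNIV - {j}. t $ j' powi m j') =
      of_int (m j) * (\<Prod>j\<in>UNIV. t $ j powi m j) * (h $ j / t $ j)" for h :: "real^'a" and j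
    using pos[of j] by (subst (2) prod.remove[of _ j]) (auto simp: power_int_diff)
  ultimately show ?thesis
    by (simp add: has_log_gradient_def)
qed

text \<open>The chain rule for the monomial map, which is linear with matrix \<open>V\<close> in the
  bases \<open>dt\<^sub>j / t\<^sub>j\<close> and \<open>dx\<^sub>i / x\<^sub>i\<close>.\<close>

lemma has_log_gradient_monomial_map:
  fixes V :: "int^'k^'n"
  assumes f: "has_log_gradient f G (monomial_map V x)" and x: "x \<in> positive_orthant"
  shows "has_log_gradient (\<lambda>x. f (monomial_map V x))
    (\<lambda>i. \<Sum>j\<in>UNIV. G j * of_int (V $ j $ i)) x"
proof -
  define t where "t = monomial_map V x"
  have pos: "t $ j \<noteq> 0" for j
    using x by (auto simp: t_def monomial_map_def positive_orthant_def)
       (metis less_irrefl)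
  define D where "D h = (\<chi> j. t $ j * (\<Sum>i\<in>UNIV. of_int (V $ j $ i) * (h $ i / x $ i)))" for h
  have "(monomial_map V has_derivative D) (at x)"
    unfolding has_derivative_componentwise_within[of "monomial_map V"]
  proof
    fix b :: "real^'n" assume "b \<in> Basis"
    then obtain j where b: "b = axis j 1" by (auto simp: Basis_vec_def)
    have "((\<lambda>x. monomial_map V x $ j) has_derivative (\<lambda>h. D h $ j)) (at x)"
      using has_log_gradient_monomial[OF x, of "\<lambda>i. V $ j $ i"]
      by (simp add: has_log_gradient_def D_def t_def monomial_map_def sum_distrib_left mult_ac)
    then show "((\<lambda>x. monomial_map V x \<bullet> b) has_derivative (\<lambda>h. D h \<bullet> b)) (at x)"
      by (simp add: b inner_axis)
  qed
  from has_derivative_compose[OF this] f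
  have "((\<lambda>x. f (monomial_map V x)) has_derivative
      (\<lambda>h. \<Sum>j\<in>UNIV. G j * (D h $ j / t $ j))) (at x)"
    unfolding has_log_gradient_def t_def by blast
  moreover have "D h $ j / t $ j = (\<Sum>i\<in>UNIV. of_int (V $ j $ i) * (h $ i / x $ i))" for h j
    using pos[of j] by (simp add: D_def)
  then have "(\<Sum>j\<in>UNIV. G j * (D h $ j / t $ j)) =
      (\<Sum>i\<in>UNIV. (\<Sum>j\<in>UNIV. G j * of_int (V $ j $ i)) * (h $ i / x $ i))" for h
    unfolding sum_distrib_right
    by (subst sum.swap) (simp add: sum_distrib_left mult_ac)
  ultimately show ?thesis
    by (simp add: has_log_gradient_def)
qed

section \<open>The toric Hessian as a covariance matrix\<close>

text \<open>Up to the normalisation by \<open>q\<close>, this is the expectation of \<open>g\<close> for the distribution with weights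
  proportional to \<open>c\<^sub>a t\<^sup>a\<close>.\<close>

definition moment_sum ::
    "(real^'n) set \<Rightarrow> (real^'n \<Rightarrow> real) \<Rightarrow> (real^'n \<Rightarrow> real) \<Rightarrow> real^'n \<Rightarrow> real" where
  "moment_sum A c g t = (\<Sum>a\<in>A. g a * (c a * laurent_monomial a t))"

text \<open>Differentiating \<open>t\<^sup>a\<close> logarithmically multiplies it by the coordinates of \<open>a\<close>, so these sums are
  closed under the Euler operators: all derivatives of \<open>q\<close> are again moments.\<close>

lemma has_log_gradient_moment_sum:
  assumes "\<And>a j. a \<in> A \<Longrightarrow> a $ j \<in> \<int>" "t \<in> positive_orthant"
  shows "has_log_gradient (moment_sum A c g) (\<lambda>j. moment_sum A c (\<lambda>a. g a * a $ j) t) t"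
proof -
  have "has_log_gradient (\<lambda>t. \<Sum>a\<in>A. (g a * c a) * laurent_monomial a t)
      (\<lambda>j. \<Sum>a\<in>A. (g a * c a) * (of_int \<lfloor>a $ j\<rfloor> * laurent_monomial a t)) t"
    using has_log_gradient_monomial[OF assms(2)]
    by (intro has_log_gradient_sum has_log_gradient_cmult) (simp add: laurent_monomial_def[abs_def])
  moreover have "of_int \<lfloor>a $ j\<rfloor> = a $ j" if "a \<in> A" for a j
    using assms(1)[OF that] by (metis Ints_cases floor_of_int)
  ultimately show ?thesis
    by (simp add: moment_sum_def[abs_def] mult_ac)
qed

locale positive_lattice_weights =
  fixes A :: "(real^'n) set" and c :: "real^'n \<Rightarrow> real"
  assumes finite_support: "finite A" and nonempty: "A \<noteq> {}"
    and integral: "a \<in> A \<Longrightarrow> a $ j \<in> \<int>"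
    and positive: "a \<in> A \<Longrightarrow> c a > 0"
begin

abbreviation q where "q \<equiv> moment_sum A c (\<lambda>_. 1)"

abbreviation covariance where
  "covariance t \<equiv> \<chi> i j. moment_sum A c (\<lambda>a. a $ i * a $ j) t / q t -
     moment_sum A c (\<lambda>a. a $ i) t * moment_sum A c (\<lambda>a. a $ j) t / (q t)\<^sup>2"

lemma weight_positive:
  assumes "t \<in> positive_orthant" "a \<in> A"
  shows "c a * laurent_monomial a t > 0"
  using assms positive by (simp add: laurent_monomial_def positive_orthant_def prod_pos)

lemma q_positive: "t \<in> positive_orthant \<Longrightarrow> q t > 0"
  using finite_support nonempty weight_positive by (simp add: moment_sum_def sum_pos)

lemma has_log_gradient_mean:
  assumes "t \<in> positive_orthant"
  shows "has_log_gradient (\<lambda>t. moment_sum A c (\<lambda>a. a $ j) t / q t) (\<lambda>i. covariance t $ i $ j) t"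
proof -
  have "has_log_gradient (\<lambda>t. moment_sum A c (\<lambda>a. a $ j) t / q t)
      (\<lambda>i. moment_sum A c (\<lambda>a. a $ j * a $ i) t / q t -
        moment_sum A c (\<lambda>a. a $ j) t * moment_sum A c (\<lambda>a. 1 * a $ i) t / (q t)\<^sup>2) t"
    using q_positive[OF assms] integral assms
    by (intro has_log_gradient_divide has_log_gradient_moment_sum) auto
  then show ?thesis
    by (simp add: mult.commute)
qed

lemma euler_operator_q:
  assumes "t \<in> positive_orthant"
  shows "euler_operator j q t = moment_sum A c (\<lambda>a. a $ j) t"
  using euler_operator_eqI[OF has_log_gradient_moment_sum, of A t j c "\<lambda>_. 1"] assms integral
  by (simp add: positive_orthant_def order_less_imp_not_eq2)

lemma euler_operator_ln_q:
  assumes "t \<in> positive_orthant"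
  shows "euler_operator j (\<lambda>t. ln (q t)) t = moment_sum A c (\<lambda>a. a $ j) t / q t"
  using euler_operator_eqI[OF has_log_gradient_ln[OF has_log_gradient_moment_sum], of A t c "\<lambda>_. 1"]
    assms integral q_positive[OF assms]
  by (simp add: positive_orthant_def order_less_imp_not_eq2)

lemma toric_hessian_ln_q:
  assumes "t \<in> positive_orthant"
  shows "toric_hessian (\<lambda>t. ln (q t)) t = covariance t"
proof -
  have "euler_operator i (euler_operator j (\<lambda>t. ln (q t))) t = covariance t $ i $ j" for i j
    using has_log_gradient_cong[OF has_log_gradient_mean assms euler_operator_ln_q] assms
    by (intro euler_operator_eqI) (auto simp: positive_orthant_def order_less_imp_not_eq2)
  then show ?thesis
    by (simp add: toric_hessian_def vec_eq_iff)
qed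

text \<open>The quadratic form at \<open>v\<close> is the variance of \<open>a \<mapsto> v \<bullet> a\<close>; the computation is the usual passage
  from \<open>E(Y\<^sup>2) - (E Y)\<^sup>2\<close> to \<open>E((Y - E Y)\<^sup>2)\<close>.\<close>

lemma covariance_quadratic_form:
  assumes "t \<in> positive_orthant"
  defines "\<mu> \<equiv> \<chi> j. moment_sum A c (\<lambda>a. a $ j) t / q t"
  shows "v \<bullet> (covariance t *v v) = moment_sum A c (\<lambda>a. (v \<bullet> (a - \<mu>))\<^sup>2) t / q t"
proof -
  let ?M = "\<lambda>g. moment_sum A c g t"
  have q: "q t \<noteq> 0" using q_positive[OF assms(1)] by simp
  define m where "m = v \<bullet> \<mu>"
  have linear: "(\<Sum>i\<in>UNIV. b i * ?M (g i)) = ?M (\<lambda>a. \<Sum>i\<in>UNIV. b i * g i a)"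
    for b :: "'n \<Rightarrow> real" and g
    unfolding moment_sum_def sum_distrib_left sum_distrib_right
    by (subst sum.swap) (simp add: mult_ac)
  have mean: "?M (\<lambda>a. v \<bullet> a) = m * q t"
  proof -
    have "m * q t = (\<Sum>j\<in>UNIV. v $ j * ?M (\<lambda>a. a $ j))"
      unfolding m_def \<mu>_def inner_vec_def sum_distrib_right using q by simp
    then show ?thesis
      by (simp add: linear inner_vec_def)
  qed
  have "v \<bullet> (covariance t *v v) =
      (\<Sum>i\<in>UNIV. \<Sum>j\<in>UNIV. v $ i * (v $ j * ?M (\<lambda>a. a $ i * a $ j)) / q t -
        (v $ i * ?M (\<lambda>a. a $ i)) * (v $ j * ?M (\<lambda>a. a $ j)) / (q t)\<^sup>2)"
    by (simp add: inner_vec_def matrix_vector_mult_def sum_distrib_left algebra_simps)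
  also have "\<dots> = (\<Sum>i\<in>UNIV. v $ i * (\<Sum>j\<in>UNIV. v $ j * ?M (\<lambda>a. a $ i * a $ j))) / q t -
      (\<Sum>i\<in>UNIV. v $ i * ?M (\<lambda>a. a $ i)) * (\<Sum>j\<in>UNIV. v $ j * ?M (\<lambda>a. a $ j)) / (q t)\<^sup>2"
    by (simp add: sum_subtractf sum_product) (simp add: sum_distrib_left sum_divide_distrib)
  also have "\<dots> = ?M (\<lambda>a. (v \<bullet> a)\<^sup>2) / q t - (?M (\<lambda>a. v \<bullet> a))\<^sup>2 / (q t)\<^sup>2"
    by (simp add: linear inner_vec_def power2_eq_square sum_product sum_distrib_left mult_ac)
  also have "\<dots> = (?M (\<lambda>a. (v \<bullet> a)\<^sup>2) - 2 * m * ?M (\<lambda>a. v \<bullet> a) + m\<^sup>2 * q t) / q t"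
    using q by (simp add: mean field_simps power2_eq_square)
  also have "?M (\<lambda>a. (v \<bullet> a)\<^sup>2) - 2 * m * ?M (\<lambda>a. v \<bullet> a) + m\<^sup>2 * q t =
      ?M (\<lambda>a. (v \<bullet> (a - \<mu>))\<^sup>2)"
    unfolding moment_sum_def sum_distrib_left sum_subtractf[symmetric] sum.distrib[symmetric]
    by (rule sum.cong) (auto simp: inner_diff_right m_def power2_eq_square algebra_simps)
  finally show ?thesis .
qed

lemma det_covariance_positive:
  assumes "t \<in> positive_orthant" and span: "\<And>v b. v \<noteq> 0 \<Longrightarrow> \<exists>a\<in>A. v \<bullet> a \<noteq> b"
  shows "det (covariance t) > 0"
proof (rule det_positive_definite)
  fix v :: "real^'n" assume "v \<noteq> 0"
  define \<mu> where "\<mu> = (\<chi> j. moment_sum A c (\<lambda>a. a $ j) t / q t)"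
  obtain a where a: "a \<in> A" "v \<bullet> a \<noteq> v \<bullet> \<mu>" using span[OF \<open>v \<noteq> 0\<close>] by blast
  have "moment_sum A c (\<lambda>a. (v \<bullet> (a - \<mu>))\<^sup>2) t > 0"
    unfolding moment_sum_def using finite_support a weight_positive[OF assms(1)]
    by (intro sum_pos2[of _ a]) (auto simp: inner_diff_right less_imp_le)
  then show "v \<bullet> (covariance t *v v) > 0"
    using q_positive[OF assms(1)] covariance_quadratic_form[OF assms(1), of v]
    by (simp add: \<mu>_def)
qed
end

section \<open>Rational functions\<close>

lemma rational_function_on_const: "rational_function_on S (\<lambda>_. b)"
  unfolding rational_function_on_def
  by (intro exI[of _ "\<lambda>_. b"] exI[of _ "\<lambda>_. 1"]) auto

lemma rational_function_on_coordinate: "rational_function_on S (\<lambda>x. x $ i)"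
  unfolding rational_function_on_def
  by (intro exI[of _ "\<lambda>x. x $ i"] exI[of _ "\<lambda>_. 1"]) (auto intro: bounded_linear_vec_nth)

lemma rational_function_on_add:
  assumes "rational_function_on S r" "rational_function_on S s"
  shows "rational_function_on S (\<lambda>x. r x + s x)"
proof -
  obtain f g f' g' where
    "real_polynomial_function f" "real_polynomial_function g" "\<forall>x\<in>S. g x \<noteq> 0 \<and> r x = f x / g x"
    "real_polynomial_function f'" "real_polynomial_function g'" "\<forall>x\<in>S. g' x \<noteq> 0 \<and> s x = f' x / g' x"
    using assms unfolding rational_function_on_def by blast
  then show ?thesis
    unfolding rational_function_on_def
    by (intro exI[of _ "\<lambda>x. f x * g' x + f' x * g x"] exI[of _ "\<lambda>x. g x * g' x"])
      (auto simp: add_frac_eq)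
qed

lemma rational_function_on_mult:
  assumes "rational_function_on S r" "rational_function_on S s"
  shows "rational_function_on S (\<lambda>x. r x * s x)"
proof -
  obtain f g f' g' where
    "real_polynomial_function f" "real_polynomial_function g" "\<forall>x\<in>S. g x \<noteq> 0 \<and> r x = f x / g x"
    "real_polynomial_function f'" "real_polynomial_function g'" "\<forall>x\<in>S. g' x \<noteq> 0 \<and> s x = f' x / g' x"
    using assms unfolding rational_function_on_def by blast
  then show ?thesis
    unfolding rational_function_on_def
    by (intro exI[of _ "\<lambda>x. f x * f' x"] exI[of _ "\<lambda>x. g x * g' x"]) auto
qed

lemma rational_function_on_inverse:
  assumes "rational_function_on S r" "\<And>x. x \<in> S \<Longrightarrow> r x \<noteq> 0"
  shows "rational_function_on S (\<lambda>x. inverse (r x))"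
proof -
  obtain f g where
    "real_polynomial_function f" "real_polynomial_function g" "\<forall>x\<in>S. g x \<noteq> 0 \<and> r x = f x / g x"
    using assms(1) unfolding rational_function_on_def by blast
  with assms(2) show ?thesis
    unfolding rational_function_on_def
    by (intro exI[of _ g] exI[of _ f]) fastforce
qed

lemma rational_function_on_divide:
  assumes "rational_function_on S r" "rational_function_on S s" "\<And>x. x \<in> S \<Longrightarrow> s x \<noteq> 0"
  shows "rational_function_on S (\<lambda>x. r x / s x)"
  unfolding divide_inverse
  using assms by (intro rational_function_on_mult rational_function_on_inverse)

lemma rational_function_on_diff:
  assumes "rational_function_on S r" "rational_function_on S s"
  shows "rational_function_on S (\<lambda>x. r x - s x)"
  using rational_function_on_add[OF assms(1) rational_function_on_mult[OF
      rational_function_on_const[of S "-1"] assms(2)]]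
  by simp

lemma rational_function_on_sum:
  assumes "\<And>i. i \<in> I \<Longrightarrow> rational_function_on S (r i)"
  shows "rational_function_on S (\<lambda>x. \<Sum>i\<in>I. r i x)"
  using assms by (induction I rule: infinite_finite_induct)
    (auto intro: rational_function_on_const rational_function_on_add)

lemma rational_function_on_prod:
  assumes "\<And>i. i \<in> I \<Longrightarrow> rational_function_on S (r i)"
  shows "rational_function_on S (\<lambda>x. \<Prod>i\<in>I. r i x)"
  using assms by (induction I rule: infinite_finite_induct)
    (auto intro: rational_function_on_const rational_function_on_mult)

lemma rational_function_on_power:
  assumes "rational_function_on S r"
  shows "rational_function_on S (\<lambda>x. r x ^ m)"
  using assms by (induction m)
    (auto intro: rational_function_on_const rational_function_on_mult)

lemma rational_function_on_powi:
  assumes "rational_function_on S r" "\<And>x. x \<in> S \<Longrightarrow> r x \<noteq> 0"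
  shows "rational_function_on S (\<lambda>x. r x powi m)"
  using assms unfolding power_int_def
  by (cases "m \<ge> 0") (simp_all add: rational_function_on_power rational_function_on_inverse)

lemma rational_function_on_det:
  assumes "\<And>i j. rational_function_on S (\<lambda>x. M x $ i $ j)"
  shows "rational_function_on S (\<lambda>x. det (M x))"
  unfolding det_def using assms
  by (intro rational_function_on_sum rational_function_on_mult rational_function_on_const
      rational_function_on_prod)

lemma rational_function_on_monomial_map:
  "rational_function_on positive_orthant (\<lambda>x. monomial_map V x $ j)"
  by (auto simp: monomial_map_def positive_orthant_def order_less_imp_not_eq2
      intro!: rational_function_on_prod rational_function_on_powi rational_function_on_coordinate)

lemma (in positive_lattice_weights) rational_covariance:
  fixes V :: "int^'k::finite^'n"
  shows "rational_function_on positive_orthant (\<lambda>x. det (covariance (monomial_map V x)))"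
proof -
  have nz: "monomial_map V x $ j \<noteq> 0" if "x \<in> positive_orthant" for x :: "real^'k" and j
    using monomial_map_positive[OF that, of V] by (simp add: positive_orthant_def order_less_imp_not_eq2)
  have M: "rational_function_on positive_orthant (\<lambda>x. moment_sum A c g (monomial_map V x))" for g
    unfolding moment_sum_def laurent_monomial_def
    by (intro rational_function_on_sum rational_function_on_mult rational_function_on_const
        rational_function_on_prod rational_function_on_powi rational_function_on_monomial_map nz)
  have q: "q (monomial_map V x) \<noteq> 0" if "x \<in> positive_orthant" for x :: "real^'k"
    using q_positive[OF monomial_map_positive[OF that], of V] by simp
  have "rational_function_on positive_orthant (\<lambda>x. covariance (monomial_map V x) $ i $ j)" for i j
    using M q
    by (auto intro!: rational_function_on_diff rational_function_on_divide rational_function_on_mult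
        rational_function_on_power)
  then show ?thesis
    by (rule rational_function_on_det)
qed

section \<open>Forms of top degree in Cox coordinates\<close>

lemma pullback_volume_form:
  fixes F :: "real^'k::finite \<Rightarrow> real^'n::finite" and J :: "real^'k^'n"
  assumes "\<And>i. has_log_gradient (\<lambda>y. F y $ i) (\<lambda>k. J $ i $ k) x"
  shows "pullback F volume_form x w = det (J ** (\<chi> k l. w l $ k / x $ k))"
proof -
  define D where "D h = (\<chi> i. \<Sum>k\<in>UNIV. J $ i $ k * (h $ k / x $ k))" for h
  have "(F has_derivative D) (at x)"
    unfolding has_derivative_componentwise_within[of F]
  proof
    fix b :: "real^'n" assume "b \<in> Basis"
    then obtain i where "b = axis i 1" by (auto simp: Basis_vec_def)
    then show "((\<lambda>y. F y \<bullet> b) has_derivative (\<lambda>h. D h \<bullet> b)) (at x)"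
      using assms[of i] by (simp add: has_log_gradient_def D_def inner_axis)
  qed
  then have "frechet_derivative F (at x) = D"
    by (rule frechet_derivative_at[symmetric])
  then show ?thesis
    by (simp add: pullback_def volume_form_def wedge_def coord_differential_def D_def
        matrix_matrix_mult_def)
qed

text \<open>With \<open>\<eta>\<^sub>j = \<Sum>\<^sub>i V\<^sub>j\<^sub>i dx\<^sub>i / x\<^sub>i\<close>, the pullback of \<open>dt\<^sub>j / t\<^sub>j\<close>, the canonical form is
  the wedge product of the \<open>\<eta>\<^sub>j\<close>, and its expansion into coordinate forms is the Cauchy-Binet formula.\<close>

lemma canonical_form_eq_det:
  "canonical_form V x w = det ((\<chi> j i. real_of_int (V $ j $ i)) ** (\<chi> i l. w l $ i / x $ i))"
  unfolding cauchy_binet canonical_form_def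
  by (intro sum.cong refl)
    (simp add: column_submatrix_def wedge_def log_differential_def det_of_int_matrix)

section \<open>The pullback of the volume form\<close>

lemma lattice_polytope_vertices:
  assumes "lattice_polytope P"
  shows "finite (vertices P)" and "convex hull vertices P = P"
    and "\<And>a j. a \<in> vertices P \<Longrightarrow> a $ j \<in> \<int>"
proof -
  have P: "polytope P" using assms by (simp add: lattice_polytope_def)
  show "finite (vertices P)"
    using finite_polyhedron_extreme_points[OF polytope_imp_polyhedron[OF P]]
    by (simp add: vertices_def)
  show "convex hull vertices P = P"
    using Krein_Milman_Minkowski[of P] P
    by (simp add: vertices_def polytope_imp_compact polytope_imp_convex)
  show "a $ j \<in> \<int>" if "a \<in> vertices P" for a j
    using assms that by (simp add: lattice_polytope_def)
qed

lemma not_contained_in_hyperplane: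
  fixes P :: "(real^'n::finite) set"
  assumes "aff_dim P = int CARD('n)" "convex hull A = P" "v \<noteq> 0"
  shows "\<exists>a\<in>A. v \<bullet> a \<noteq> b"
proof (rule ccontr)
  assume "\<not> ?thesis"
  then have "A \<subseteq> {y. v \<bullet> y = b}" by auto
  then have "P \<subseteq> {y. v \<bullet> y = b}"
    using assms(2) hull_minimal[of A "{y. v \<bullet> y = b}" convex] convex_hyperplane by blast
  then have "aff_dim P \<le> int CARD('n) - 1"
    using aff_dim_subset[of P "{y. v \<bullet> y = b}"] assms(3) by simp
  with assms(1) show False by simp
qed

theorem proposition5p1:
  fixes P :: "(real^'n::{finite,linorder}) set"
    and V :: "int^'k::{finite,linorder}^'n::{finite,linorder}"
    and c :: "real^'n::{finite,linorder} \<Rightarrow> real"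
  assumes "lattice_polytope P"
    and "simple_polytope P"
    and "aff_dim P = int CARD('n)"
    and "facet_normal_matrix P V"
    and "\<And>a. a \<in> vertices P \<Longrightarrow> c a > 0"
  shows "\<exists>r.
    rational_function_on positive_orthant r \<and>
    (\<forall>x\<in>positive_orthant. r x > 0) \<and>
    (\<forall>x\<in>positive_orthant. \<forall>w.
       pullback (moment_map P V c \<circ> cox_quotient P V \<circ> complex_vec) volume_form x w =
       r x * canonical_form V x w) \<and>
    (\<forall>x\<in>positive_orthant.
       r x = det (toric_hessian (\<lambda>t. ln (vertex_polynomial P c t)) (monomial_map V x)))"
proof -
  have P: "polytope P" "convex P" "P \<noteq> {}"
    using assms(1,3) by (auto simp: lattice_polytope_def polytope_imp_convex)
  note vertices = lattice_polytope_vertices[OF assms(1)]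
  interpret positive_lattice_weights "vertices P" c
    using vertices P(3) assms(5) by unfold_locales auto
  have q: "vertex_polynomial P c = q"
    by (simp add: vertex_polynomial_def moment_sum_def fun_eq_iff)
  define r where "r x = det (toric_hessian (\<lambda>t. ln (vertex_polynomial P c t)) (monomial_map V x))" for x
  have r: "r x = det (covariance (monomial_map V x))" if "x \<in> positive_orthant" for x
    by (simp only: r_def q toric_hessian_ln_q[OF monomial_map_positive[OF that]])
  have "rational_function_on positive_orthant r"
    using rational_covariance[of V] by (simp add: rational_function_on_def r)
  moreover have "r x > 0" if "x \<in> positive_orthant" for x
    unfolding r[OF that]
    using monomial_map_positive[OF that] not_contained_in_hyperplane[OF assms(3) vertices(2)]
    by (rule det_covariance_positive)
  moreover have "pullback (moment_map P V c \<circ> cox_quotient P V \<circ> complex_vec) volume_form x w =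
      r x * canonical_form V x w" if x: "x \<in> positive_orthant" for x w
  proof -
    let ?t = "monomial_map V x"
    let ?F = "moment_map P V c \<circ> cox_quotient P V \<circ> complex_vec"
    let ?V = "\<chi> j i. real_of_int (V $ j $ i)"
    have F: "?F y $ j = moment_sum (vertices P) c (\<lambda>a. a $ j) (monomial_map V y) /
        q (monomial_map V y)" if "y \<in> positive_orthant" for y j
      using moment_map_cox_quotient[OF P(3,2) that, of V c]
      by (simp add: affine_moment_map_def q euler_operator_q monomial_map_positive[OF that])
    \<comment> \<open>Row \<open>j\<close> of the Jacobian combines the rows of \<open>V\<close> with the entries of column \<open>j\<close> of the Hessian,
      which is why the transpose occurs.\<close>
    have "has_log_gradient (\<lambda>y. ?F y $ j) (\<lambda>k. (transpose (covariance ?t) ** ?V) $ j $ k) x" for j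
      using has_log_gradient_cong[OF has_log_gradient_monomial_map[OF
            has_log_gradient_mean[OF monomial_map_positive[OF x]] x] x F]
      by (simp add: matrix_matrix_mult_def transpose_def)
    then have "pullback ?F volume_form x w =
        det (transpose (covariance ?t) ** ?V ** (\<chi> k l. w l $ k / x $ k))"
      by (rule pullback_volume_form)
    also have "\<dots> = det (covariance ?t) * canonical_form V x w"
      by (simp only: matrix_mul_assoc[symmetric] det_mul[of "transpose _"] det_transpose
          canonical_form_eq_det)
    finally show ?thesis
      by (simp only: r[OF x])
  qed
  ultimately show ?thesis
    using r_def by blast
qed

end
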